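(* Let $k\in\mathbb N$ and let $(Q,S)$ be a threshold representation. The following statements are equivalent: (i) $G(Q,S)$ is star $k$-choosable; (ii) $G(Q,S)$ admits a star $k$-coloring; (iii) no index of $Q$ is $k$-forbidden for $(Q,S)$.
   Context: All graphs are finite and simple. A threshold representation is a pair $(Q,S)$ of sequences of natural numbers $Q=q_1,\dots,q_{r+1}$, $S=s_1,\dots,s_r$. The graph $G(Q,S)$ has vertex set partitioned into cliques $Q_1,\dots,Q_{r+1}$ with $|Q_i|=q_i$ and independent sets $S_1,\dots,S_r$ with $|S_i|=s_i$, where for $1\le i\le j\le r$ every vertex of $Q_i$ is adjacent to every vertex of $S_j\cup Q_{j+1}$, vertices within each $Q_i$ are pairwise adjacent, and there are no other edges. For a sequence $T=t_1,\dots$ and $c\in\mathbb N$, write $T=[c]$ if every term equals $c$ (vacuously true for the empty sequence); for indices $i,j$, $Q(i,j)$ denotes $q_{i+1},\dots,q_{j-1}$ and $S[i,j)$ denotes $s_i,\dots,s_{j-1}$. An index $i$ of $Q$ is $k$-forbidden for $(Q,S)$ if either $q_i>k$, or $q_i=k$ and there is an index $j>i$ with $q_j=k$, $Q(i,j)=[k-1]$ and $S[i,j)=[1]$. A star of a graph is a vertex set inducing $K_{1,m}$ ($m\ge1$); maximal stars are stars not properly contained in another star. A $k$-coloring is a map into $\{1,\dots,k\}$; a star $k$-coloring has no monochromatic maximal star. For a $k$-list assignment $L$ ($L(v)\subseteq\mathbb N$, $|L(v)|=k$), an $L$-coloring satisfies $\rho(v)\in L(v)$; the graph is star $k$-choosable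 if for every $k$-list assignment $L$ there is an $L$-coloring with no monochromatic maximal star.
   Formalization: The case k = 1 is excluded, since the equivalence fails there: Q = 1,1 and S = 2 give K_{1,3}, with no 1-forbidden index but no star 1-coloring. Terms of Q and S are taken to be positive. *)

theory Defs
  imports "Graph_Theory.Kuratowski"
begin

text \<open>
  Graphs are the symmetric, loop-free digraphs of the library. A star is identified with its
  vertex set.
\<close>

definition star :: "('a, 'b) pre_digraph \<Rightarrow> 'a set \<Rightarrow> bool" where
  "star G X \<longleftrightarrow> X \<subseteq> verts G \<and> (\<exists>m\<ge>1. K\<^bsub>1,m\<^esub> (G \<restriction> X))"

definition maximal_star :: "('a, 'b) pre_digraph \<Rightarrow> 'a set \<Rightarrow> bool" where
  "maximal_star G X \<longleftrightarrow> star G X \<and> \<not> (\<exists>Y. star G Y \<and> X \<subset> Y)"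

definition monochromatic :: "('a \<Rightarrow> nat) \<Rightarrow> 'a set \<Rightarrow> bool" where
  "monochromatic \<rho> X \<longleftrightarrow> (\<exists>c. \<forall>v\<in>X. \<rho> v = c)"

definition k_coloring :: "nat \<Rightarrow> ('a, 'b) pre_digraph \<Rightarrow> ('a \<Rightarrow> nat) \<Rightarrow> bool" where
  "k_coloring k G \<rho> \<longleftrightarrow> (\<forall>v\<in>verts G. \<rho> v \<in> {1..k})"

definition star_k_coloring :: "nat \<Rightarrow> ('a, 'b) pre_digraph \<Rightarrow> ('a \<Rightarrow> nat) \<Rightarrow> bool" where
  "star_k_coloring k G \<rho> \<longleftrightarrow>
     k_coloring k G \<rho> \<and> \<not> (\<exists>X. maximal_star G X \<and> monochromatic \<rho> X)"

text \<open>Finiteness is required explicitly because infinite sets have \<open>card\<close> zero.\<close>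

definition k_list_assignment :: "nat \<Rightarrow> ('a, 'b) pre_digraph \<Rightarrow> ('a \<Rightarrow> nat set) \<Rightarrow> bool" where
  "k_list_assignment k G L \<longleftrightarrow> (\<forall>v\<in>verts G. finite (L v) \<and> card (L v) = k)"

definition L_coloring :: "('a, 'b) pre_digraph \<Rightarrow> ('a \<Rightarrow> nat set) \<Rightarrow> ('a \<Rightarrow> nat) \<Rightarrow> bool" where
  "L_coloring G L \<rho> \<longleftrightarrow> (\<forall>v\<in>verts G. \<rho> v \<in> L v)"

definition star_k_choosable :: "nat \<Rightarrow> ('a, 'b) pre_digraph \<Rightarrow> bool" where
  "star_k_choosable k G \<longleftrightarrow>
     (\<forall>L. k_list_assignment k G L \<longrightarrow>
        (\<exists>\<rho>. L_coloring G L \<rho> \<and> \<not> (\<exists>X. maximal_star G X \<and> monochromatic \<rho> X)))"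

text \<open>
  Sequences are lists, so all indices are shifted down by one: \<open>Q ! i\<close> is $q_{i+1}$ and
  \<open>S ! i\<close> is $s_{i+1}$. Their terms are positive natural numbers; with zero terms the
  characterisation fails, e.g. for $Q = 2,2$, $S = 0$ (the graph $K_4$) and
  $Q = 2,0$, $S = 1$ (the graph $K_3$), both with $k = 2$.
\<close>

definition threshold_rep :: "nat list \<Rightarrow> nat list \<Rightarrow> bool" where
  "threshold_rep Q S \<longleftrightarrow>
     length Q = length S + 1 \<and> (\<forall>q\<in>set Q. q > 0) \<and> (\<forall>s\<in>set S. s > 0)"

text \<open>\<open>QV i a\<close> and \<open>SV i a\<close> are the \<open>a\<close>-th vertices of the clique and of the
  independent set with index \<open>i\<close>.\<close>

datatype tvertex = QV nat nat | SV nat nat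

definition Q_block :: "nat list \<Rightarrow> nat \<Rightarrow> tvertex set" where
  "Q_block Q i = {QV i a | a. a < Q ! i}"

definition S_block :: "nat list \<Rightarrow> nat \<Rightarrow> tvertex set" where
  "S_block S i = {SV i a | a. a < S ! i}"

definition threshold_verts :: "nat list \<Rightarrow> nat list \<Rightarrow> tvertex set" where
  "threshold_verts Q S = (\<Union>i<length Q. Q_block Q i) \<union> (\<Union>i<length S. S_block S i)"

text \<open>One direction of each edge between different blocks, and both directions of the edges
  inside the cliques.\<close>

definition threshold_arcs :: "nat list \<Rightarrow> nat list \<Rightarrow> (tvertex \<times> tvertex) set" where
  "threshold_arcs Q S =
     {(u, v). \<exists>i<length Q. u \<in> Q_block Q i \<and> v \<in> Q_block Q i \<and> u \<noteq> v} \<union>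
     {(u, v). \<exists>i j. i \<le> j \<and> j < length S \<and>
        u \<in> Q_block Q i \<and> v \<in> S_block S j \<union> Q_block Q (j + 1)}"

definition threshold_graph :: "nat list \<Rightarrow> nat list \<Rightarrow> (tvertex, tvertex \<times> tvertex) pre_digraph"
  where
  "threshold_graph Q S = with_proj
     \<lparr> pverts = threshold_verts Q S,
       parcs = threshold_arcs Q S \<union> (threshold_arcs Q S)\<inverse> \<rparr>"

definition k_forbidden :: "nat \<Rightarrow> nat list \<Rightarrow> nat list \<Rightarrow> nat \<Rightarrow> bool" where
  "k_forbidden k Q S i \<longleftrightarrow>
     Q ! i > k \<or>
     Q ! i = k \<and>
       (\<exists>j. i < j \<and> j < length Q \<and> Q ! j = k \<and>
          (\<forall>l. i < l \<and> l < j \<longrightarrow> Q ! l = k - 1) \<and>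
          (\<forall>l. i \<le> l \<and> l < j \<longrightarrow> S ! l = 1))"

lemma threshold_graph_graph:
  assumes "threshold_rep Q S"
  shows "graph (threshold_graph Q S)"
proof -
  let ?P = "\<lparr> pverts = threshold_verts Q S,
       parcs = threshold_arcs Q S \<union> (threshold_arcs Q S)\<inverse> \<rparr>"
  have fin: "finite (threshold_verts Q S)"
    by (auto simp: threshold_verts_def Q_block_def S_block_def)
  have len: "length Q = Suc (length S)"
    using assms by (simp add: threshold_rep_def)
  have sub: "threshold_arcs Q S \<subseteq> threshold_verts Q S \<times> threshold_verts Q S"
    using len by (fastforce simp: threshold_arcs_def threshold_verts_def)
  have irr: "u \<noteq> v" if "(u, v) \<in> threshold_arcs Q S" for u v
    using that by (auto simp: threshold_arcs_def Q_block_def S_block_def)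
  have "finite (threshold_arcs Q S)"
    using sub fin by (meson finite_SigmaI finite_subset)
  moreover have "symmetric (with_proj ?P)"
    by (auto simp: symmetric_def sym_def)
  ultimately have "pair_graph ?P"
    using fin sub irr by unfold_locales (auto dest: irr)
  then show ?thesis
    unfolding threshold_graph_def by (rule pair_graph.pair_graphD_graph)
qed

lemma induce_subgraph_verts_eq: "wf_digraph H \<Longrightarrow> H \<restriction> verts H = H"
  by (auto intro!: pre_digraph.equality simp: wf_digraph_def)

text \<open>
  The equivalence does not extend to $k = 1$: a graph is star $1$-colorable only if it has no
  edges, while no index is $1$-forbidden for $Q = 1,1$, $S = 2$, which represents $K_{1,3}$.
\<close>

lemma k_eq_1_counterexample:
  shows "threshold_rep [1, 1] [2]"
    and "\<not> (\<exists>i<length [1, 1::nat]. k_forbidden 1 [1, 1] [2] i)"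
    and "\<not> (\<exists>\<rho>. star_k_coloring 1 (threshold_graph [1, 1] [2]) \<rho>)"
proof -
  show rep: "threshold_rep [1, 1] [2]"
    by (simp add: threshold_rep_def)
  show "\<not> (\<exists>i<length [1, 1::nat]. k_forbidden 1 [1, 1] [2] i)"
  proof (clarify)
    fix i assume i: "i < length [1, 1::nat]" and f: "k_forbidden 1 [1, 1] [2] i"
    from i consider "i = 0" | "i = 1" by fastforce
    then show False
      using f by cases (auto simp: k_forbidden_def)
  qed
  let ?G = "threshold_graph [1, 1] [2]"
  let ?V = "{QV 0 0, QV 1 0, SV 0 0, SV 0 1}"
  let ?W = "{QV 1 0, SV 0 0, SV 0 1}"
  have Q: "Q_block [1, 1] 0 = {QV 0 0}" "Q_block [1, 1] (Suc 0) = {QV 1 0}"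
    by (auto simp: Q_block_def)
  have S: "S_block [2] 0 = {SV 0 0, SV 0 1}"
    by (auto simp: S_block_def)
  have "verts ?G = Q_block [1, 1] 0 \<union> Q_block [1, 1] (Suc 0) \<union> S_block [2] 0"
    unfolding threshold_graph_def threshold_verts_def by (auto simp: lessThan_Suc)
  then have V: "verts ?G = ?V"
    unfolding Q S by auto
  have "threshold_arcs [1, 1] [2] =
      {(u, v). u \<in> Q_block [1, 1] 0 \<and> v \<in> Q_block [1, 1] 0 \<and> u \<noteq> v} \<union>
      {(u, v). u \<in> Q_block [1, 1] (Suc 0) \<and> v \<in> Q_block [1, 1] (Suc 0) \<and> u \<noteq> v} \<union>
      Q_block [1, 1] 0 \<times> (S_block [2] 0 \<union> Q_block [1, 1] (Suc 0))"
    unfolding threshold_arcs_def by (auto simp: less_Suc_eq)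
  then have "threshold_arcs [1, 1] [2] = {QV 0 0} \<times> ?W"
    unfolding Q S by auto
  then have A: "arcs_ends ?G = {QV 0 0} \<times> ?W \<union> ?W \<times> {QV 0 0}"
    unfolding threshold_graph_def by auto
  have "wf_digraph ?G"
    using threshold_graph_graph[OF rep] by (simp add: graph_def digraph_def fin_digraph_def)
  then have "?G \<restriction> ?V = ?G"
    unfolding V[symmetric] by (rule induce_subgraph_verts_eq)
  moreover have "K\<^bsub>1,3\<^esub> ?G"
    unfolding complete_bipartite_digraph_def V A
    by (intro conjI, rule threshold_graph_graph[OF rep], rule exI[of _ "{QV 0 0}"], rule exI[of _ ?W]) auto
  ultimately have "star ?G ?V"
    unfolding star_def V by (intro conjI exI[of _ 3]) simp_all
  then have "maximal_star ?G ?V"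
    unfolding maximal_star_def star_def V by blast
  then show "\<not> (\<exists>\<rho>. star_k_coloring 1 ?G \<rho>)"
    unfolding star_k_coloring_def k_coloring_def monochromatic_def V
    unfolding atLeastAtMost_singleton singleton_iff by blast
qed

end

theory Submission
  imports Defs
begin

text \<open>
  The maximal stars are exactly the sets consisting of two distinct clique vertices
  $u \in Q_i$, $w \in Q_j$ with $i \le j$ together with $S_i \cup \dots \cup S_{j-1}$. Reading
  the blocks from left to right, call a color threatened at \<open>l\<close> if it occurs in some $Q_i$ with
  $i < l$ and is the only color on $S_i, \dots, S_{l-1}$. A coloring is good iff every $Q_l$ is
  rainbow and avoids the colors threatened at \<open>l\<close>, of which there is at most one. With
  \<open>k\<close> colors, a clique of size \<open>k\<close> followed by a singleton independent set forces a threat, a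
  clique of size $k - 1$ followed by a singleton passes a threat on, and a threatened clique of
  size \<open>k\<close> cannot be colored. In all other situations a greedy choice from the lists removes
  the threat.
\<close>

section \<open>Maximal stars of threshold graphs\<close>

text \<open>In the induced graph two vertices are adjacent exactly when one of them, but not both,
  is the center \<open>u\<close>. The condition \<open>X \<noteq> {u}\<close> encodes the presence
  of a leaf.\<close>

lemma (in graph) star_iff:
  "star G X \<longleftrightarrow> X \<subseteq> verts G \<and> (\<exists>u\<in>X. X \<noteq> {u} \<and>
     (\<forall>v\<in>X. \<forall>w\<in>X. v \<rightarrow>\<^bsub>G\<^esub> w \<longleftrightarrow> (v = u) \<noteq> (w = u)))"
  (is "_ \<longleftrightarrow> _ \<and> ?center")
proof (cases "X \<subseteq> verts G")
  case True
  let ?H = "G \<restriction> X"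
  have fin: "finite X"
    using True finite_verts by (rule finite_subset)
  have ind: "induced_subgraph ?H G"
    using True by (rule induced_induce)
  interpret H: digraph ?H
    using ind by (rule digraphI_induced)
  interpret H: sym_digraph ?H
    using ind by (rule induced_graph_imp_graph)
  have graph_H: "graph ?H"
    by unfold_locales
  have ends: "arcs_ends ?H = {(v, w). v \<in> X \<and> w \<in> X \<and> v \<rightarrow>\<^bsub>G\<^esub> w}"
    by (auto simp: arcs_ends_def arc_to_ends_def)
  have "(\<exists>m\<ge>1. K\<^bsub>1,m\<^esub> ?H) \<longleftrightarrow> ?center"
  proof
    assume "\<exists>m\<ge>1. K\<^bsub>1,m\<^esub> ?H"
    then obtain m U V where m: "m \<ge> 1" and X: "X = U \<union> V" "U \<inter> V = {}" "card U = 1" "card V = m"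
      and arcs: "arcs_ends ?H = U \<times> V \<union> V \<times> U"
      by (auto simp: complete_bipartite_digraph_def)
    from X(3) obtain u where u: "U = {u}"
      by (auto simp: card_1_singleton_iff)
    have "V \<noteq> {}"
      using m X(4) by auto
    moreover have "(v \<rightarrow>\<^bsub>G\<^esub> w) \<longleftrightarrow> (v = u) \<noteq> (w = u)" if "v \<in> X" "w \<in> X" for v w
    proof -
      have "v \<rightarrow>\<^bsub>G\<^esub> w \<longleftrightarrow> (v, w) \<in> arcs_ends ?H"
        using that ends by auto
      then show ?thesis
        using that X(1,2) u unfolding arcs by auto
    qed
    ultimately show ?center
      using X(1,2) u by (intro bexI[of _ u]) auto
  next
    assume ?center
    then obtain u where u: "u \<in> X" "X \<noteq> {u}"
      and adj: "\<And>v w. v \<in> X \<Longrightarrow> w \<in> X \<Longrightarrow> v \<rightarrow>\<^bsub>G\<^esub> w \<longleftrightarrow> (v = u) \<noteq> (w = u)"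
      by blast
    have "arcs_ends ?H = {u} \<times> (X - {u}) \<union> (X - {u}) \<times> {u}"
      unfolding ends using u(1) adj by auto
    then have "K\<^bsub>1,card (X - {u})\<^esub> ?H"
      unfolding complete_bipartite_digraph_def
      using u(1) graph_H
      by (intro conjI, blast, rule_tac exI[of _ "{u}"], rule_tac exI[of _ "X - {u}"]) auto
    moreover have "card (X - {u}) \<ge> 1"
      using u fin by (subst One_nat_def, subst Suc_le_eq, subst card_gt_0_iff) auto
    ultimately show "\<exists>m\<ge>1. K\<^bsub>1,m\<^esub> ?H"
      by blast
  qed
  then show ?thesis
    using True by (simp add: star_def)
qed (simp add: star_def)

text \<open>All cliques together form one big clique, so on actual vertices adjacency depends only
  on block indices and on distinctness.\<close>

fun threshold_adj :: "tvertex \<Rightarrow> tvertex \<Rightarrow> bool" where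
  "threshold_adj (QV i a) (QV j b) \<longleftrightarrow> (i, a) \<noteq> (j, b)"
| "threshold_adj (QV i a) (SV j b) \<longleftrightarrow> i \<le> j"
| "threshold_adj (SV i a) (QV j b) \<longleftrightarrow> j \<le> i"
| "threshold_adj (SV i a) (SV j b) \<longleftrightarrow> False"

lemma QV_in_Q_block [simp]: "QV i a \<in> Q_block Q j \<longleftrightarrow> i = j \<and> a < Q ! j"
  by (auto simp: Q_block_def)

lemma SV_notin_Q_block [simp]: "SV i a \<notin> Q_block Q j"
  by (auto simp: Q_block_def)

lemma SV_in_S_block [simp]: "SV i a \<in> S_block S j \<longleftrightarrow> i = j \<and> a < S ! j"
  by (auto simp: S_block_def)

lemma QV_notin_S_block [simp]: "QV i a \<notin> S_block S j"
  by (auto simp: S_block_def)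

lemma Q_block_eq_image: "Q_block Q i = QV i ` {..<Q ! i}"
  by (auto simp: Q_block_def)

lemma finite_Q_block [simp]: "finite (Q_block Q i)"
  by (simp add: Q_block_eq_image)

lemma card_Q_block [simp]: "card (Q_block Q i) = Q ! i"
  by (simp add: Q_block_eq_image card_image inj_on_def)

lemma verts_threshold_graph [simp]: "verts (threshold_graph Q S) = threshold_verts Q S"
  by (simp add: threshold_graph_def)

lemma QV_in_threshold_verts [simp]:
  "QV i a \<in> threshold_verts Q S \<longleftrightarrow> i < length Q \<and> a < Q ! i"
  by (auto simp: threshold_verts_def)

lemma SV_in_threshold_verts [simp]:
  "SV i a \<in> threshold_verts Q S \<longleftrightarrow> i < length S \<and> a < S ! i"
  by (auto simp: threshold_verts_def)

lemma dominates_threshold_graph_iff: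
  assumes "length Q = length S + 1" "u \<in> threshold_verts Q S" "v \<in> threshold_verts Q S"
  shows "u \<rightarrow>\<^bsub>threshold_graph Q S\<^esub> v \<longleftrightarrow> threshold_adj u v"
proof -
  have clique: "(QV i a, QV j b) \<in> threshold_arcs Q S \<longleftrightarrow> i < j \<or> i = j \<and> a \<noteq> b"
    if "i < length Q" "j < length Q" "a < Q ! i" "b < Q ! j" for i j a b
  proof (cases "i < j")
    case True
    \<comment> \<open>Arcs from clique \<open>i\<close> to a later clique \<open>j\<close> are
      listed under the index \<open>j - 1\<close> of the preceding independent set.\<close>
    then have "i \<le> j - 1" "j - 1 < length S" "j = j - 1 + 1"
      using that assms(1) by auto
    then show ?thesis
      unfolding threshold_arcs_def using True that by auto
  qed (use that in \<open>auto simp: threshold_arcs_def\<close>)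
  have mixed: "(QV i a, SV j b) \<in> threshold_arcs Q S \<longleftrightarrow> i \<le> j"
    if "a < Q ! i" "b < S ! j" "j < length S" for i j a b
    using that by (auto simp: threshold_arcs_def)
  have no_S: "(SV i a, v) \<notin> threshold_arcs Q S" for i a v
    by (auto simp: threshold_arcs_def)
  have "u \<rightarrow>\<^bsub>threshold_graph Q S\<^esub> v \<longleftrightarrow>
      (u, v) \<in> threshold_arcs Q S \<or> (v, u) \<in> threshold_arcs Q S"
    by (simp add: threshold_graph_def)
  then show ?thesis
    using assms(2,3) by (cases u; cases v) (auto simp: clique mixed no_S)
qed

lemma star_threshold_graph_iff:
  assumes "threshold_rep Q S"
  shows "star (threshold_graph Q S) X \<longleftrightarrow> X \<subseteq> threshold_verts Q S \<and>
    (\<exists>u\<in>X. X \<noteq> {u} \<and> (\<forall>v\<in>X. \<forall>w\<in>X. threshold_adj v w \<longleftrightarrow> (v = u) \<noteq> (w = u)))"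
proof -
  have len: "length Q = length S + 1"
    using assms by (simp add: threshold_rep_def)
  show ?thesis
    unfolding graph.star_iff[OF threshold_graph_graph[OF assms]] verts_threshold_graph
    using dominates_threshold_graph_iff[OF len] by (smt (verit, best) subset_iff)
qed

text \<open>For \<open>i \<le> j\<close> the center is \<open>u\<close>: it is adjacent to the
  independent sets from index \<open>i\<close> on, while \<open>w\<close> is adjacent only to those
  from \<open>j\<close> on. For \<open>i = j\<close> only an edge remains.\<close>

definition pair_star :: "nat list \<Rightarrow> nat \<Rightarrow> nat \<Rightarrow> tvertex \<Rightarrow> tvertex \<Rightarrow> tvertex set" where
  "pair_star S i j u w = {u, w} \<union> (\<Union>m\<in>{i..<j}. S_block S m)"

lemma SV_in_pair_star:
  assumes "u \<in> Q_block Q i" "w \<in> Q_block Q j"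
  shows "SV m b \<in> pair_star S i j u w \<longleftrightarrow> i \<le> m \<and> m < j \<and> b < S ! m"
  using assms by (auto simp: pair_star_def Q_block_def)

text \<open>In a larger star the center would be an end of the edge \<open>u w\<close>, so every
  third vertex would be adjacent to exactly one of \<open>u\<close> and \<open>w\<close>. A vertex
  outside the set is adjacent to both or to neither.\<close>

lemma maximal_star_pair_star:
  assumes rep: "threshold_rep Q S"
    and ij: "i \<le> j" "j < length Q"
    and u: "u \<in> Q_block Q i" and w: "w \<in> Q_block Q j" and "u \<noteq> w"
  shows "maximal_star (threshold_graph Q S) (pair_star S i j u w)"
proof -
  let ?P = "pair_star S i j u w"
  from u w obtain a b where ab: "u = QV i a" "a < Q ! i" "w = QV j b" "b < Q ! j"
    by (auto simp: Q_block_def)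
  have len: "length Q = length S + 1"
    using rep by (simp add: threshold_rep_def)
  have uw: "threshold_adj u w"
    using \<open>u \<noteq> w\<close> ab by auto
  have sub: "?P \<subseteq> threshold_verts Q S"
    using ij len ab by (auto simp: pair_star_def S_block_def)
  have "?P \<noteq> {u}"
    using \<open>u \<noteq> w\<close> by (auto simp: pair_star_def)
  moreover have "threshold_adj v x \<longleftrightarrow> (v = u) \<noteq> (x = u)" if "v \<in> ?P" "x \<in> ?P" for v x
    using that \<open>u \<noteq> w\<close> ij(1) unfolding pair_star_def ab S_block_def by auto
  moreover have "u \<in> ?P"
    by (simp add: pair_star_def)
  ultimately have star: "star (threshold_graph Q S) ?P"
    unfolding star_threshold_graph_iff[OF rep] using sub by blast
  have False if Y: "star (threshold_graph Q S) Y" "?P \<subset> Y" for Y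
  proof -
    from Y(1) obtain c where Yv: "Y \<subseteq> threshold_verts Q S" and "c \<in> Y"
      and adj: "\<And>v x. v \<in> Y \<Longrightarrow> x \<in> Y \<Longrightarrow> threshold_adj v x \<longleftrightarrow> (v = c) \<noteq> (x = c)"
      unfolding star_threshold_graph_iff[OF rep] by blast
    from Y(2) obtain x where x: "x \<in> Y" "x \<notin> ?P"
      by blast
    have uwY: "u \<in> Y" "w \<in> Y"
      using Y(2) by (auto simp: pair_star_def)
    have "c = u \<or> c = w"
      using adj[OF uwY] uw by auto
    \<comment> \<open>Clique vertices are adjacent to both ends; independent vertices with index
      below \<open>i\<close> to neither, and those from \<open>j\<close> on to both.\<close>
    moreover have "threshold_adj x u \<longleftrightarrow> threshold_adj x w"
    proof (cases x)
      case (QV l d)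
      then show ?thesis
        using x(2) ab by (auto simp: pair_star_def)
    next
      case (SV l d)
      then have "\<not> (i \<le> l \<and> l < j)"
        using x Yv by (auto simp: SV_in_pair_star[OF u w])
      then show ?thesis
        using SV ab ij(1) by auto
    qed
    moreover have "x \<noteq> u" "x \<noteq> w"
      using x(2) by (auto simp: pair_star_def)
    ultimately show False
      using adj[OF x(1) uwY(1)] adj[OF x(1) uwY(2)] \<open>u \<noteq> w\<close> by auto
  qed
  with star show ?thesis
    unfolding maximal_star_def by blast
qed

text \<open>A star has at most two clique vertices, as three form a triangle. Two of them serve as
  \<open>u\<close> and \<open>w\<close>; if there is only one, a vertex of the last clique, which
  has no independent neighbor, takes the place of \<open>w\<close>.\<close>

lemma star_subset_pair_star:
  assumes rep: "threshold_rep Q S" and X: "star (threshold_graph Q S) X"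
  obtains i j u w where "i \<le> j" "j < length Q" "u \<in> Q_block Q i" "w \<in> Q_block Q j" "u \<noteq> w"
    "X \<subseteq> pair_star S i j u w"
proof -
  have len: "length Q = length S + 1"
    using rep by (simp add: threshold_rep_def)
  have last: "QV (length S) 0 \<in> Q_block Q (length S)"
    using rep by (simp add: threshold_rep_def)
  from X obtain c where Xv: "X \<subseteq> threshold_verts Q S" and c: "c \<in> X" "X \<noteq> {c}"
    and adj: "\<And>v x. v \<in> X \<Longrightarrow> x \<in> X \<Longrightarrow> threshold_adj v x \<longleftrightarrow> (v = c) \<noteq> (x = c)"
    unfolding star_threshold_graph_iff[OF rep] by blast
  note pair = that
  \<comment> \<open>The case of a single clique vertex \<open>u\<close>. The vertex
    \<open>SV l d\<close> ensures \<open>i < length S\<close>, so that the added vertex of the last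
    clique differs from \<open>u\<close>.\<close>
  have to_last: thesis if "u = QV i a" "u \<in> X" "SV l d \<in> X" "i \<le> l"
    and leaves: "\<And>x. x \<in> X \<Longrightarrow> x \<noteq> u \<Longrightarrow> \<exists>l d. x = SV l d \<and> i \<le> l" for u i a l d
  proof (rule pair[of i "length S" u "QV (length S) 0"])
    have l: "l < length S"
      using that(3) Xv by auto
    then show "i \<le> length S" "u \<noteq> QV (length S) 0"
      using that(1,4) by auto
    show "u \<in> Q_block Q i"
      using that(1,2) Xv by auto
    show "X \<subseteq> pair_star S i (length S) u (QV (length S) 0)"
    proof
      fix x assume x: "x \<in> X"
      show "x \<in> pair_star S i (length S) u (QV (length S) 0)"
      proof (cases "x = u")
        case False
        then obtain l' d' where "x = SV l' d'" "i \<le> l'"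
          using leaves[OF x] by blast
        then show ?thesis
          using x Xv by (auto simp: pair_star_def)
      qed (simp add: pair_star_def)
    qed
  qed (use len last in auto)
  show thesis
  proof (cases c)
    case (SV l d)
    from c obtain w where w: "w \<in> X" "w \<noteq> c"
      by blast
    then obtain i a where ia: "w = QV i a" "i \<le> l"
      using adj[OF w(1) c(1)] SV by (cases w) auto
    \<comment> \<open>The center is independent, so a second leaf \<open>x\<close> would be a clique
      vertex and adjacent to \<open>w\<close>, closing a triangle.\<close>
    have "x = c" if x: "x \<in> X" "x \<noteq> w" for x
    proof (rule ccontr)
      assume "x \<noteq> c"
      then have "\<not> threshold_adj x w" "threshold_adj x c"
        using adj[OF x(1) w(1)] adj[OF x(1) c(1)] w(2) by auto
      then show False
        using x(2) ia SV by (cases x) auto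
    qed
    then show thesis
      using to_last[OF ia(1) w(1)] c SV ia by blast
  next
    case (QV i a)
    show thesis
    proof (cases "\<exists>j b. QV j b \<in> X \<and> QV j b \<noteq> c")
      case True
      then obtain j b where w: "QV j b \<in> X" "QV j b \<noteq> c"
        by blast
      \<comment> \<open>A further leaf is adjacent to the center in clique \<open>i\<close> but not
        to the leaf in clique \<open>j\<close>, which confines its index to
        \<open>{i..<j}\<close>.\<close>
      have others: "\<exists>l d. x = SV l d \<and> i \<le> l \<and> l < j"
        if x: "x \<in> X" "x \<noteq> c" "x \<noteq> QV j b" for x
        using adj[OF x(1) w(1)] adj[OF x(1) c(1)] w(2) x QV by (cases x) auto
      show thesis
      proof (cases "i \<le> j")
        case True
        show thesis
        proof (rule that[of i j c "QV j b"])
          show "X \<subseteq> pair_star S i j c (QV j b)"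
          proof
            fix x assume x: "x \<in> X"
            show "x \<in> pair_star S i j c (QV j b)"
            proof (cases "x = c \<or> x = QV j b")
              case False
              then obtain l d where "x = SV l d" "i \<le> l" "l < j"
                using others[OF x] by blast
              then show ?thesis
                using x Xv by (auto simp: pair_star_def)
            qed (auto simp: pair_star_def)
          qed
        qed (use True w Xv c QV in auto)
      next
        case False
        \<comment> \<open>With \<open>j < i\<close> no such index exists, so the star is a single
          edge and its ends swap roles.\<close>
        then have "X \<subseteq> {QV j b, c}"
          using others by fastforce
        then have "X \<subseteq> pair_star S j i (QV j b) c"
          by (auto simp: pair_star_def)
        moreover have "j \<le> i" "i < length Q" "QV j b \<in> Q_block Q j" "c \<in> Q_block Q i"
          using False w(1) c(1) Xv QV by auto
        ultimately show thesis
          using that w(2) by blast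
      qed
    next
      case False
      have S: "\<exists>l d. x = SV l d \<and> i \<le> l" if x: "x \<in> X" "x \<noteq> c" for x
        using adj[OF x(1) c(1)] x False QV by (cases x) auto
      from c obtain x where "x \<in> X" "x \<noteq> c"
        by blast
      then show thesis
        using S to_last[OF QV c(1)] by blast
    qed
  qed
qed

lemma maximal_star_iff_pair_star:
  assumes "threshold_rep Q S"
  shows "maximal_star (threshold_graph Q S) X \<longleftrightarrow>
    (\<exists>i j u w. i \<le> j \<and> j < length Q \<and> u \<in> Q_block Q i \<and> w \<in> Q_block Q j \<and> u \<noteq> w \<and>
       X = pair_star S i j u w)"
proof
  assume X: "maximal_star (threshold_graph Q S) X"
  then have "star (threshold_graph Q S) X"
    by (simp add: maximal_star_def)
  then obtain i j u w where *: "i \<le> j" "j < length Q" "u \<in> Q_block Q i" "w \<in> Q_block Q j" "u \<noteq> w"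
    and sub: "X \<subseteq> pair_star S i j u w"
    by (rule star_subset_pair_star[OF assms])
  have "star (threshold_graph Q S) (pair_star S i j u w)"
    using maximal_star_pair_star[OF assms *] by (simp add: maximal_star_def)
  then have "X = pair_star S i j u w"
    using X sub by (auto simp: maximal_star_def)
  with * show "\<exists>i j u w. i \<le> j \<and> j < length Q \<and> u \<in> Q_block Q i \<and> w \<in> Q_block Q j \<and> u \<noteq> w \<and>
       X = pair_star S i j u w"
    by blast
qed (use maximal_star_pair_star[OF assms] in blast)

section \<open>Threats\<close>

primrec threat :: "nat list \<Rightarrow> nat list \<Rightarrow> (tvertex \<Rightarrow> nat) \<Rightarrow> nat \<Rightarrow> nat set" where
  "threat Q S \<rho> 0 = {}"
| "threat Q S \<rho> (Suc l) = {c \<in> threat Q S \<rho> l \<union> \<rho> ` Q_block Q l. \<forall>v\<in>S_block S l. \<rho> v = c}"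

lemma threat_iff:
  "c \<in> threat Q S \<rho> l \<longleftrightarrow>
     (\<exists>i<l. \<exists>u\<in>Q_block Q i. \<rho> u = c \<and> (\<forall>m\<in>{i..<l}. \<forall>v\<in>S_block S m. \<rho> v = c))"
proof (induction l)
  case (Suc l)
  have "(\<forall>m\<in>{i..<Suc l}. \<forall>v\<in>S_block S m. \<rho> v = c) \<longleftrightarrow>
     (\<forall>m\<in>{i..<l}. \<forall>v\<in>S_block S m. \<rho> v = c) \<and> (\<forall>v\<in>S_block S l. \<rho> v = c)" if "i < Suc l" for i
    using that by (auto simp: atLeastLessThanSuc)
  then have "(\<exists>i<Suc l. \<exists>u\<in>Q_block Q i. \<rho> u = c \<and>
        (\<forall>m\<in>{i..<Suc l}. \<forall>v\<in>S_block S m. \<rho> v = c)) \<longleftrightarrow>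
      (\<exists>i<Suc l. \<exists>u\<in>Q_block Q i. \<rho> u = c \<and> (\<forall>m\<in>{i..<l}. \<forall>v\<in>S_block S m. \<rho> v = c)) \<and>
      (\<forall>v\<in>S_block S l. \<rho> v = c)"
    by blast
  \<comment> \<open>The index \<open>i = l\<close> has the empty range \<open>{l..<l}\<close> and
    contributes exactly the colors of clique \<open>l\<close>.\<close>
  also have "\<dots> \<longleftrightarrow> (c \<in> threat Q S \<rho> l \<or> (\<exists>u\<in>Q_block Q l. \<rho> u = c)) \<and>
      (\<forall>v\<in>S_block S l. \<rho> v = c)"
    unfolding Suc.IH less_Suc_eq by (simp add: ex_disj_distrib conj_disj_distribR)
  finally show ?case
    by (simp add: image_iff) metis
qed simp

text \<open>Lets the greedy construction color a block without disturbing the threats at its own and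
  earlier indices.\<close>

lemma threat_cong:
  assumes "\<And>i v. i < l \<Longrightarrow> v \<in> Q_block Q i \<union> S_block S i \<Longrightarrow> \<rho> v = \<rho>' v"
  shows "threat Q S \<rho> l = threat Q S \<rho>' l"
  using assms
proof (induction l)
  case (Suc l)
  have "\<rho> ` Q_block Q l = \<rho>' ` Q_block Q l"
    using Suc.prems[of l] by (intro image_cong) auto
  moreover have "threat Q S \<rho> l = threat Q S \<rho>' l"
    using Suc.prems less_SucI by (intro Suc.IH) blast
  ultimately show ?case
    using Suc.prems[of l] by auto
qed simp

definition unthreatened :: "nat list \<Rightarrow> nat list \<Rightarrow> (tvertex \<Rightarrow> nat) \<Rightarrow> nat \<Rightarrow> bool" where
  "unthreatened Q S \<rho> j \<longleftrightarrow>
     inj_on \<rho> (Q_block Q j) \<and> \<rho> ` Q_block Q j \<inter> threat Q S \<rho> j = {}"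

text \<open>Pairs within one clique give injectivity, since their maximal star is an edge; pairs
  with \<open>i < j\<close> give the threats to clique \<open>j\<close>.\<close>

lemma no_monochromatic_maximal_star_iff:
  assumes "threshold_rep Q S"
  shows "\<not> (\<exists>X. maximal_star (threshold_graph Q S) X \<and> monochromatic \<rho> X) \<longleftrightarrow>
    (\<forall>j<length Q. unthreatened Q S \<rho> j)"
proof -
  have mono: "monochromatic \<rho> (pair_star S i j u w) \<longleftrightarrow>
      \<rho> u = \<rho> w \<and> (\<forall>m\<in>{i..<j}. \<forall>v\<in>S_block S m. \<rho> v = \<rho> w)" for i j u w
    by (auto simp: monochromatic_def pair_star_def)
  have "unthreatened Q S \<rho> j \<longleftrightarrow>
     \<not> (\<exists>i u w. i \<le> j \<and> u \<in> Q_block Q i \<and> w \<in> Q_block Q j \<and> u \<noteq> w \<and>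
          monochromatic \<rho> (pair_star S i j u w))" for j
  proof -
    have "inj_on \<rho> (Q_block Q j) \<longleftrightarrow>
       \<not> (\<exists>u w. u \<in> Q_block Q j \<and> w \<in> Q_block Q j \<and> u \<noteq> w \<and>
            monochromatic \<rho> (pair_star S j j u w))"
      unfolding mono inj_on_def by auto
    moreover have "\<rho> ` Q_block Q j \<inter> threat Q S \<rho> j = {} \<longleftrightarrow>
       \<not> (\<exists>i u w. i < j \<and> u \<in> Q_block Q i \<and> w \<in> Q_block Q j \<and>
            monochromatic \<rho> (pair_star S i j u w))"
    proof -
      have "\<rho> ` Q_block Q j \<inter> threat Q S \<rho> j = {} \<longleftrightarrow>
          (\<forall>w\<in>Q_block Q j. \<rho> w \<notin> threat Q S \<rho> j)"
        by blast
      then show ?thesis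
        unfolding mono threat_iff by blast
    qed
    moreover have "u \<noteq> w" if "i < j" "u \<in> Q_block Q i" "w \<in> Q_block Q j" for i u w
      using that by (auto simp: Q_block_def)
    ultimately show ?thesis
      unfolding unthreatened_def by (metis le_less)
  qed
  then show ?thesis
    unfolding maximal_star_iff_pair_star[OF assms] by blast
qed

section \<open>Forbidden indices obstruct star colorings\<close>

text \<open>By pigeonhole, induction from \<open>i\<close> to \<open>j\<close> shows that some color
  is threatened at each index after \<open>i\<close> up to \<open>j\<close>. The rainbow clique of
  size \<open>k\<close> at \<open>j\<close> uses every color, including a threatened one.\<close>

lemma unthreatened_imp_not_forbidden:
  assumes rep: "threshold_rep Q S"
    and col: "k_coloring k (threshold_graph Q S) \<rho>"
    and free: "\<And>j. j < length Q \<Longrightarrow> unthreatened Q S \<rho> j"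
    and i: "i < length Q"
  shows "\<not> k_forbidden k Q S i"
proof
  assume forb: "k_forbidden k Q S i"
  have len: "length Q = length S + 1"
    using rep by (simp add: threshold_rep_def)
  have range: "\<rho> ` Q_block Q j \<subseteq> {1..k}" if "j < length Q" for j
    using col that by (auto simp: k_coloring_def Q_block_def)
  have card: "card (\<rho> ` Q_block Q j) = Q ! j" if "j < length Q" for j
    using free[OF that] by (simp add: unthreatened_def card_image)
  have onto: "\<rho> ` Q_block Q j = {1..k}" if "j < length Q" "Q ! j = k" for j
    using range[OF that(1)] card[OF that(1)] that(2) by (intro card_subset_eq) auto
  have "Q ! i \<le> k"
    using card_mono[OF _ range[OF i]] card[OF i] by simp
  with forb obtain j where Qi: "Q ! i = k" and j: "i < j" "j < length Q" "Q ! j = k"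
    and Q: "\<And>l. i < l \<Longrightarrow> l < j \<Longrightarrow> Q ! l = k - 1"
    and S: "\<And>l. i \<le> l \<Longrightarrow> l < j \<Longrightarrow> S ! l = 1"
    by (auto simp: k_forbidden_def)
  have threat_range: "threat Q S \<rho> l \<subseteq> {1..k}" if "l \<le> length Q" for l
  proof
    fix c assume "c \<in> threat Q S \<rho> l"
    then obtain m where "m < l" "c \<in> \<rho> ` Q_block Q m"
      unfolding threat_iff by blast
    then show "c \<in> {1..k}"
      using range[of m] that by auto
  qed
  \<comment> \<open>The single independent vertex must repeat a color that is threatened or used on
    clique \<open>l\<close>, and so it passes on or creates a threat.\<close>
  have propagate: "threat Q S \<rho> (Suc l) \<noteq> {}"
    if "i \<le> l" "l < j" "threat Q S \<rho> l \<union> \<rho> ` Q_block Q l = {1..k}" for l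
  proof -
    have "S_block S l = {SV l 0}"
      using S[OF that(1,2)] by (auto simp: S_block_def)
    moreover have "\<rho> (SV l 0) \<in> {1..k}"
      using col S[OF that(1,2)] that(2) j(2) len by (auto simp: k_coloring_def)
    ultimately have "\<rho> (SV l 0) \<in> threat Q S \<rho> (Suc l)"
      using that(3) by simp
    then show ?thesis
      by blast
  qed
  have "l \<le> j \<Longrightarrow> threat Q S \<rho> l \<noteq> {}" if "Suc i \<le> l" for l
    using that
  proof (induction l rule: dec_induct)
    case base
    show ?case
      using propagate[of i] onto[OF i Qi] threat_range[of i] i j by auto
  next
    case (step l)
    then have l: "l < length Q" "Q ! l = k - 1" "threat Q S \<rho> l \<noteq> {}"
      using j Q by auto
    \<comment> \<open>A nonempty threat is disjoint from the \<open>k - 1\<close> colors on clique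
      \<open>l\<close>, so together they exhaust \<open>{1..k}\<close>.\<close>
    have "threat Q S \<rho> l \<union> \<rho> ` Q_block Q l = {1..k}"
    proof (rule card_seteq)
      have "finite (threat Q S \<rho> l)"
        using threat_range[of l] l(1) by (auto intro: finite_subset)
      then have "card (threat Q S \<rho> l \<union> \<rho> ` Q_block Q l) = card (threat Q S \<rho> l) + (k - 1)"
        using free[OF l(1)] card[OF l(1)] l(2)
        by (subst card_Un_disjoint) (auto simp: unthreatened_def)
      moreover have "card (threat Q S \<rho> l) \<ge> 1"
        using l(3) \<open>finite (threat Q S \<rho> l)\<close> by (simp add: Suc_le_eq card_gt_0_iff)
      ultimately show "card {1..k} \<le> card (threat Q S \<rho> l \<union> \<rho> ` Q_block Q l)"
        by simp
    qed (use threat_range[of l] range[OF l(1)] l(1) in auto)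
    then show ?case
      using propagate[of l] step by simp
  qed
  then have "threat Q S \<rho> j \<noteq> {}"
    using j(1) by simp
  then show False
    using free[OF j(2)] onto[OF j(2,3)] threat_range[of j] j(2) by (auto simp: unthreatened_def)
qed

section \<open>Greedy list coloring\<close>

text \<open>Each element can be treated last: fewer than \<open>card A\<close> colors are then
  taken, so its list still offers a new one.\<close>

lemma ex_inj_on_choice:
  assumes "finite A" "\<And>x. x \<in> A \<Longrightarrow> finite (L x)" "\<And>x. x \<in> A \<Longrightarrow> card A \<le> card (L x)"
  shows "\<exists>f. inj_on f A \<and> (\<forall>x\<in>A. f x \<in> L x)"
  using assms
proof (induction A rule: finite_induct)
  case (insert a A)
  have "\<exists>f. inj_on f A \<and> (\<forall>x\<in>A. f x \<in> L x)"
    using insert.prems insert.hyps by (intro insert.IH) (auto intro: Suc_leD)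
  then obtain f where f: "inj_on f A" "\<And>x. x \<in> A \<Longrightarrow> f x \<in> L x"
    by blast
  have "card (f ` A) < card (L a)"
    using insert.prems(2)[of a] insert.hyps card_image_le[of A f] by simp
  then obtain c where c: "c \<in> L a" "c \<notin> f ` A"
    using insert.hyps(1) by (metis card_mono finite_imageI leD subsetI)
  have "inj_on (f(a := c)) (insert a A)"
    using f(1) c(2) insert.hyps(2) by (auto simp: inj_on_def)
  moreover have "\<forall>x\<in>insert a A. (f(a := c)) x \<in> L x"
    using f(2) c(1) by auto
  ultimately show ?case
    by blast
qed simp

text \<open>The pattern of a forbidden index whose closing clique of size \<open>k\<close>, at
  \<open>l\<close>, is left open. The greedy coloring allows a threat at \<open>l\<close> only if
  this pattern is present.\<close>

definition forbidden_prefix :: "nat \<Rightarrow> nat list \<Rightarrow> nat list \<Rightarrow> nat \<Rightarrow> bool" where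
  "forbidden_prefix k Q S l \<longleftrightarrow> (\<exists>i<l. Q ! i = k \<and> (\<forall>m. i < m \<and> m < l \<longrightarrow> Q ! m = k - 1) \<and>
     (\<forall>m. i \<le> m \<and> m < l \<longrightarrow> S ! m = 1))"

lemma forbidden_prefix_SucI:
  assumes "S ! l = 1" "Q ! l = k \<or> forbidden_prefix k Q S l \<and> Q ! l = k - 1"
  shows "forbidden_prefix k Q S (Suc l)"
  using assms(2)
proof
  assume "Q ! l = k"
  then show ?thesis
    using assms(1) unfolding forbidden_prefix_def
    by (intro exI[of _ l]) (auto simp: less_Suc_eq_le dest: le_antisym)
next
  assume "forbidden_prefix k Q S l \<and> Q ! l = k - 1"
  then show ?thesis
    using assms(1) unfolding forbidden_prefix_def less_Suc_eq by blast
qed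

lemma k_forbidden_if_prefix:
  assumes "forbidden_prefix k Q S l" "l < length Q" "Q ! l = k"
  shows "\<exists>i<length Q. k_forbidden k Q S i"
proof -
  obtain i where "i < l" "Q ! i = k" "\<forall>m. i < m \<and> m < l \<longrightarrow> Q ! m = k - 1"
    "\<forall>m. i \<le> m \<and> m < l \<longrightarrow> S ! m = 1"
    using assms(1) unfolding forbidden_prefix_def by blast
  then have "i < length Q" "k_forbidden k Q S i"
    using assms(2,3) unfolding k_forbidden_def by auto
  then show ?thesis
    by blast
qed

text \<open>A threatened color fills the nonempty independent set just before \<open>l\<close>, so
  there is only one candidate.\<close>

lemma card_threat_le_1:
  assumes "\<And>m. m < l \<Longrightarrow> S ! m > 0"
  shows "finite (threat Q S \<rho> l) \<and> card (threat Q S \<rho> l) \<le> 1"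
proof (cases l)
  case (Suc m)
  then have "SV m 0 \<in> S_block S m"
    using assms by simp
  then have "threat Q S \<rho> l \<subseteq> {\<rho> (SV m 0)}"
    using Suc by auto
  then show ?thesis
    by (metis card_mono finite.emptyI finite_insert finite_subset is_singletonI is_singleton_altdef)
qed simp

text \<open>Here \<open>T\<close> is the set of colors threatened at \<open>l\<close> and \<open>C\<close> the set of colors used on the
  clique \<open>l\<close>, so that the second conjunct bounds the threat at \<open>l + 1\<close>.\<close>

lemma ex_S_block_coloring:
  assumes L: "\<And>v. v \<in> S_block S l \<Longrightarrow> finite (L v) \<and> card (L v) = k"
    and "2 \<le> k" "S ! l > 0" "Q ! l \<le> k" "finite T" "card T \<le> 1"
    and prefix: "T \<noteq> {} \<Longrightarrow> forbidden_prefix k Q S l"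
    and C: "finite C" "card C \<le> Q ! l"
  shows "\<exists>g. (\<forall>v\<in>S_block S l. g v \<in> L v) \<and>
    ({c \<in> T \<union> C. \<forall>v\<in>S_block S l. g v = c} \<noteq> {} \<longrightarrow> forbidden_prefix k Q S (Suc l))"
proof (cases "S ! l = 1")
  case True
  then have block: "S_block S l = {SV l 0}"
    by (auto simp: S_block_def)
  show ?thesis
  proof (cases "forbidden_prefix k Q S (Suc l)")
    case True
    \<comment> \<open>The implication about threats holds trivially here, so any color from the list
      will do.\<close>
    have "L v \<noteq> {}" if "v \<in> S_block S l" for v
      using L[OF that] \<open>2 \<le> k\<close> by auto
    with True show ?thesis
      by (intro exI[of _ "\<lambda>v. SOME c. c \<in> L v"]) (auto simp: some_in_eq)
  next
    case False
    \<comment> \<open>Without the pattern, clique \<open>l\<close> has size below \<open>k\<close>,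
      and below \<open>k - 1\<close> if there is a threat. Hence the list has a color outside
      \<open>T \<union> C\<close>.\<close>
    have "card (T \<union> C) < k"
    proof -
      have "Q ! l \<noteq> k" "T = {} \<or> Q ! l \<noteq> k - 1"
        using False forbidden_prefix_SucI[OF True] prefix by blast+
      then have "card T + card C < k"
        using assms(4,6) C(2) by auto
      then show ?thesis
        using card_Un_le[of T C] by linarith
    qed
    then have "\<not> L (SV l 0) \<subseteq> T \<union> C"
      using L[of "SV l 0"] block card_mono[of "T \<union> C" "L (SV l 0)"] C(1) assms(5) by auto
    then obtain c where "c \<in> L (SV l 0)" "c \<notin> T \<union> C"
      by blast
    then show ?thesis
      unfolding block by (intro exI[of _ "\<lambda>_. c"]) auto
  qed
next
  case False
  then have S: "SV l 0 \<in> S_block S l" "SV l 1 \<in> S_block S l"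
    using assms(3) by auto
  \<comment> \<open>Since \<open>2 \<le> k\<close>, two vertices of the block can receive different
    colors, and then no color fills the block.\<close>
  have "\<exists>g. inj_on g {SV l 0, SV l 1} \<and> (\<forall>v\<in>{SV l 0, SV l 1}. g v \<in> L v)"
    using L S \<open>2 \<le> k\<close> by (intro ex_inj_on_choice) auto
  then obtain g where g: "g (SV l 0) \<noteq> g (SV l 1)" "g (SV l 0) \<in> L (SV l 0)" "g (SV l 1) \<in> L (SV l 1)"
    by (auto simp: inj_on_def)
  define h where "h v = (if v \<in> {SV l 0, SV l 1} then g v else SOME c. c \<in> L v)" for v
  have "L v \<noteq> {}" if "v \<in> S_block S l" for v
    using L[OF that] \<open>2 \<le> k\<close> by auto
  then have "\<forall>v\<in>S_block S l. h v \<in> L v"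
    using g by (auto simp: h_def some_in_eq)
  moreover have "h (SV l 0) \<noteq> h (SV l 1)"
    using g(1) by (simp add: h_def)
  then have "{c \<in> T \<union> C. \<forall>v\<in>S_block S l. h v = c} = {}"
    using S by force
  ultimately show ?thesis
    by (intro exI[of _ h] conjI impI) simp_all
qed

text \<open>Deleting the threatened color leaves at least \<open>k - 1\<close> choices, which
  suffices because a clique of size \<open>k\<close> faces no threat.\<close>

lemma ex_Q_block_coloring:
  assumes L: "\<And>v. v \<in> Q_block Q l \<Longrightarrow> finite (L v) \<and> card (L v) = k"
    and "Q ! l \<le> k" "finite T" "card T \<le> 1" "T \<noteq> {} \<Longrightarrow> Q ! l \<noteq> k"
  shows "\<exists>f. inj_on f (Q_block Q l) \<and> (\<forall>v\<in>Q_block Q l. f v \<in> L v - T)"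
proof (rule ex_inj_on_choice)
  fix v assume v: "v \<in> Q_block Q l"
  have "card (L v) - card T \<le> card (L v - T)"
    by (rule diff_card_le_card_Diff) fact
  moreover have "Q ! l \<le> k - card T"
    using assms(2,4,5) by (cases "T = {}") auto
  ultimately show "card (Q_block Q l) \<le> card (L v - T)"
    using L[OF v] by simp
qed (use L in auto)

text \<open>Clique \<open>l\<close> is colored before independent set \<open>l\<close>. A threat at
  \<open>l\<close> comes with a forbidden prefix, and as no index is forbidden, clique
  \<open>l\<close> then has size below \<open>k\<close>.\<close>

lemma ex_unthreatened_list_coloring:
  assumes rep: "threshold_rep Q S" and "2 \<le> k"
    and L: "k_list_assignment k (threshold_graph Q S) L"
    and ok: "\<not> (\<exists>i<length Q. k_forbidden k Q S i)"
  shows "\<exists>\<rho>. L_coloring (threshold_graph Q S) L \<rho> \<and> (\<forall>j<length Q. unthreatened Q S \<rho> j)"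
proof -
  have len: "length Q = length S + 1" and S_pos: "\<And>m. m < length S \<Longrightarrow> S ! m > 0"
    using rep by (auto simp: threshold_rep_def)
  have LQ: "finite (L v) \<and> card (L v) = k" if "v \<in> Q_block Q l" "l < length Q" for v l
    using L that by (auto simp: k_list_assignment_def Q_block_def)
  have LS: "finite (L v) \<and> card (L v) = k" if "v \<in> S_block S l" "l < length S" for v l
    using L that by (auto simp: k_list_assignment_def S_block_def)
  have Q_le: "Q ! l \<le> k" if "l < length Q" for l
    using ok that by (force simp: k_forbidden_def)
  \<comment> \<open>The invariant is split in two because cliques and independent sets are extended
    alternately, so the cliques may be one block ahead.\<close>
  define good where "good l \<rho> \<longleftrightarrow>
      (\<forall>j<l. unthreatened Q S \<rho> j \<and> (\<forall>v\<in>Q_block Q j. \<rho> v \<in> L v))" for l \<rho>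
  define good_S where "good_S l \<rho> \<longleftrightarrow> (\<forall>j<l. \<forall>v\<in>S_block S j. \<rho> v \<in> L v) \<and>
      (threat Q S \<rho> l \<noteq> {} \<longrightarrow> forbidden_prefix k Q S l)" for l \<rho>
  have extend_Q: "\<exists>\<rho>'. good (Suc l) \<rho>' \<and> good_S l \<rho>'"
    if l: "l < length Q" and \<rho>: "good l \<rho>" "good_S l \<rho>" for l \<rho>
  proof -
    let ?T = "threat Q S \<rho> l"
    have T: "finite ?T" "card ?T \<le> 1"
      using card_threat_le_1[of l S Q \<rho>] S_pos l len by auto
    have "Q ! l \<noteq> k" if "?T \<noteq> {}"
      using that \<rho>(2) k_forbidden_if_prefix[OF _ l] ok by (auto simp: good_S_def)
    with LQ l Q_le[OF l] T
    have "\<exists>f. inj_on f (Q_block Q l) \<and> (\<forall>v\<in>Q_block Q l. f v \<in> L v - ?T)"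
      by (intro ex_Q_block_coloring[where k = k]) simp_all
    then obtain f where f: "inj_on f (Q_block Q l)" "\<forall>v\<in>Q_block Q l. f v \<in> L v - ?T"
      by blast
    define \<rho>' where "\<rho>' v = (if v \<in> Q_block Q l then f v else \<rho> v)" for v
    have new: "\<rho>' v = f v" if "v \<in> Q_block Q l" for v
      using that by (simp add: \<rho>'_def)
    have old_Q: "\<rho>' v = \<rho> v" if "v \<in> Q_block Q i" "i < l" for v i
      using that by (auto simp: \<rho>'_def Q_block_def)
    have old_S: "\<rho>' v = \<rho> v" if "v \<in> S_block S i" for v i
      using that by (auto simp: \<rho>'_def Q_block_def S_block_def)
    have threat: "threat Q S \<rho>' j = threat Q S \<rho> j" if "j \<le> l" for j
      using that old_Q old_S by (intro threat_cong) auto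
    have "inj_on \<rho>' (Q_block Q j) \<longleftrightarrow> inj_on \<rho> (Q_block Q j)"
        "\<rho>' ` Q_block Q j = \<rho> ` Q_block Q j" if "j < l" for j
      using old_Q that by (auto intro!: inj_on_cong image_cong)
    then have "unthreatened Q S \<rho>' j" if "j < l" for j
      using \<rho>(1) that threat[of j] by (simp add: unthreatened_def good_def)
    moreover have "unthreatened Q S \<rho>' l"
      using f new threat[of l] inj_on_cong[of "Q_block Q l" \<rho>' f] by (auto simp: unthreatened_def)
    ultimately have "good (Suc l) \<rho>'"
      using \<rho>(1) old_Q new f(2) by (auto simp: good_def less_Suc_eq)
    moreover have "good_S l \<rho>'"
      using \<rho>(2) old_S threat[of l] by (auto simp: good_S_def)
    ultimately show ?thesis
      by blast
  qed
  have extend_S: "\<exists>\<rho>'. good (Suc l) \<rho>' \<and> good_S (Suc l) \<rho>'"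
    if l: "l < length S" and \<rho>: "good (Suc l) \<rho>" "good_S l \<rho>" for l \<rho>
  proof -
    let ?T = "threat Q S \<rho> l" and ?C = "\<rho> ` Q_block Q l"
    have T: "finite ?T" "card ?T \<le> 1"
      using card_threat_le_1[of l S Q \<rho>] S_pos l by auto
    have "\<exists>g. (\<forall>v\<in>S_block S l. g v \<in> L v) \<and>
      ({c \<in> ?T \<union> ?C. \<forall>v\<in>S_block S l. g v = c} \<noteq> {} \<longrightarrow> forbidden_prefix k Q S (Suc l))"
    proof (rule ex_S_block_coloring)
      show "card ?C \<le> Q ! l"
        using card_image_le[of "Q_block Q l" \<rho>] by simp
      show "forbidden_prefix k Q S l" if "?T \<noteq> {}"
        using that \<rho>(2) by (simp add: good_S_def)
    qed (use LS l \<open>2 \<le> k\<close> S_pos Q_le len T in auto)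
    then obtain g where g: "\<forall>v\<in>S_block S l. g v \<in> L v"
      and prefix: "{c \<in> ?T \<union> ?C. \<forall>v\<in>S_block S l. g v = c} \<noteq> {} \<longrightarrow>
        forbidden_prefix k Q S (Suc l)"
      by blast
    define \<rho>' where "\<rho>' v = (if v \<in> S_block S l then g v else \<rho> v)" for v
    have new: "\<rho>' v = g v" if "v \<in> S_block S l" for v
      using that by (simp add: \<rho>'_def)
    have old_S: "\<rho>' v = \<rho> v" if "v \<in> S_block S i" "i < l" for v i
      using that by (auto simp: \<rho>'_def S_block_def)
    have old_Q: "\<rho>' v = \<rho> v" if "v \<in> Q_block Q i" for v i
      using that by (auto simp: \<rho>'_def Q_block_def S_block_def)
    have threat: "threat Q S \<rho>' j = threat Q S \<rho> j" if "j \<le> l" for j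
      using that old_Q old_S by (intro threat_cong) auto
    have "inj_on \<rho>' (Q_block Q j) \<longleftrightarrow> inj_on \<rho> (Q_block Q j)"
      and image: "\<rho>' ` Q_block Q j = \<rho> ` Q_block Q j" for j
      using old_Q by (auto intro!: inj_on_cong image_cong)
    then have "good (Suc l) \<rho>'"
      using \<rho>(1) threat old_Q by (simp add: good_def unthreatened_def)
    moreover have "threat Q S \<rho>' (Suc l) = {c \<in> ?T \<union> ?C. \<forall>v\<in>S_block S l. g v = c}"
      using threat[of l] image[of l] new by simp
    then have "good_S (Suc l) \<rho>'"
      using \<rho>(2) old_S new g prefix by (auto simp: good_S_def less_Suc_eq)
    ultimately show ?thesis
      by blast
  qed
  have "\<exists>\<rho>. good l \<rho> \<and> good_S l \<rho>" if "l \<le> length S" for l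
    using that
  proof (induction l)
    case 0
    show ?case
      by (simp add: good_def good_S_def)
  next
    case (Suc l)
    then show ?case
      using extend_Q[of l] extend_S[of l] len by fastforce
  qed
  \<comment> \<open>There is one more clique than independent sets, so a final clique step completes
    the coloring.\<close>
  then obtain \<rho> where "good (length Q) \<rho>" "good_S (length S) \<rho>"
    using extend_Q[of "length S"] len by auto
  then show ?thesis
    by (intro exI[of _ \<rho>])
      (auto simp: good_def good_S_def L_coloring_def threshold_verts_def)
qed

section \<open>Equivalence of choosability, colorability and absence of forbidden indices\<close>

theorem theorem41:
  fixes k :: nat and Q S :: "nat list"
  assumes "threshold_rep Q S"
    and "k \<noteq> 1"
  shows "(star_k_choosable k (threshold_graph Q S) \<longleftrightarrow>
            (\<exists>\<rho>. star_k_coloring k (threshold_graph Q S) \<rho>)) \<and>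
         ((\<exists>\<rho>. star_k_coloring k (threshold_graph Q S) \<rho>) \<longleftrightarrow>
            \<not> (\<exists>i<length Q. k_forbidden k Q S i))"
proof -
  let ?G = "threshold_graph Q S" and ?forb = "\<exists>i<length Q. k_forbidden k Q S i"
  note no_mono = no_monochromatic_maximal_star_iff[OF assms(1)]
  have colorable: "\<exists>\<rho>. star_k_coloring k ?G \<rho>" if "star_k_choosable k ?G"
  proof -
    have "k_list_assignment k ?G (\<lambda>_. {1..k})"
      by (simp add: k_list_assignment_def)
    then show ?thesis
      using that unfolding star_k_choosable_def star_k_coloring_def L_coloring_def k_coloring_def
      by blast
  qed
  have not_forb: "\<not> ?forb" if "star_k_coloring k ?G \<rho>" for \<rho>
    using that unthreatened_imp_not_forbidden[OF assms(1)]
    unfolding star_k_coloring_def no_mono by blast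
  have "star_k_choosable k ?G" if "\<not> ?forb"
  proof -
    \<comment> \<open>For \<open>k = 0\<close> the nonempty first clique would make index 0
      forbidden, so \<open>k \<noteq> 1\<close> leaves only \<open>2 \<le> k\<close>.\<close>
    have "0 < length Q" "0 < Q ! 0"
      using assms(1) by (auto simp: threshold_rep_def)
    then have "k \<noteq> 0"
      using that by (auto simp: k_forbidden_def)
    then have "2 \<le> k"
      using assms(2) by simp
    then show ?thesis
      unfolding star_k_choosable_def no_mono
      using ex_unthreatened_list_coloring[OF assms(1)] that by blast
  qed
  with colorable not_forb show ?thesis
    by blast
qed

end
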